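(* Let $n=1$, let $c\in\mathbb{F}\setminus\{0\}$, let $i\in\mathbb{Z}$, and let $f\in\mathbb{F}$ with $f\neq0$. Then the following conditions are equivalent: (1) $f\alpha_1^i$ is $c\sigma$-summable in $V_i$; (2) $f$ is $c'\sigma$-summable in $\mathbb{F}$ with $c'=c\lambda_1^i$; (3) $\lambda_1^i\neq 1/c$.
   Context: $\mathbb{F}$ is a subfield of $\overline{\mathbb{Q}}$, $\lambda_1\in\mathbb{F}\setminus\{0\}$, and $\sigma$ is the field automorphism of the rational function field $\mathbb{F}(\alpha_1)$ with $\sigma|_{\mathbb{F}}=\mathrm{id}$ and $\sigma(\alpha_1)=\lambda_1\alpha_1$. $V_i=\mathrm{span}_{\mathbb{F}}\{\alpha_1^i\}\subset\mathbb{F}(\alpha_1)$. For $e\in\mathbb{F}\setminus\{0\}$ and a subset $W\subseteq\mathbb{F}(\alpha_1)$, an element $h\in W$ is $e\sigma$-summable in $W$ if $h=e\sigma(g)-g$ for some $g\in W$. *)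

theory Defs
  imports "HOL-Algebra.Algebraic_Closure_Type" "HOL-Algebra.Embedded_Algebras"
begin

text \<open>
  Everything lives in the rational function field over the algebraic closure of the rationals;
  a subfield \<open>F\<close> of the latter is a set, and \<open>F(\<alpha>)\<close> is a subset of the big function field.
\<close>

type_synonym Qbar = "rat alg_closure"

type_synonym Qbar_ratfun = "Qbar poly fract"

abbreviation Qbar_ring :: "Qbar ring"
  where "Qbar_ring \<equiv> ring_of_type_algebra"

abbreviation Qbar_ratfun_ring :: "Qbar_ratfun ring"
  where "Qbar_ratfun_ring \<equiv> ring_of_type_algebra"

definition rf_const :: "Qbar \<Rightarrow> Qbar_ratfun"
  where "rf_const a = Fraction_Field.Fract [:a:] 1"

definition rf_var :: Qbar_ratfun
  where "rf_var = Fraction_Field.Fract [:0, 1:] 1"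

definition ratfun_field :: "Qbar set \<Rightarrow> Qbar_ratfun set"
  where "ratfun_field F =
    {Fraction_Field.Fract p q | p q. set (coeffs p) \<subseteq> F \<and> set (coeffs q) \<subseteq> F \<and> q \<noteq> 0}"

definition ratfun_field_ring :: "Qbar set \<Rightarrow> Qbar_ratfun ring"
  where "ratfun_field_ring F = Qbar_ratfun_ring\<lparr>carrier := ratfun_field F\<rparr>"

text \<open>
  Only the values on \<open>F(\<alpha>)\<close> of the function \<open>\<sigma>\<close> matter; outside it is arbitrary.
\<close>

definition scaling_automorphism :: "Qbar set \<Rightarrow> Qbar \<Rightarrow> (Qbar_ratfun \<Rightarrow> Qbar_ratfun) \<Rightarrow> bool"
  where "scaling_automorphism F lam \<sigma> \<longleftrightarrow>
    \<sigma> \<in> ring_iso (ratfun_field_ring F) (ratfun_field_ring F) \<and>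
    (\<forall>a\<in>F. \<sigma> (rf_const a) = rf_const a) \<and>
    \<sigma> rf_var = rf_const lam * rf_var"

definition V_space :: "Qbar set \<Rightarrow> int \<Rightarrow> Qbar_ratfun set"
  where "V_space F i = ring.Span Qbar_ratfun_ring (rf_const ` F) [rf_var powi i]"

definition summable_in ::
    "Qbar \<Rightarrow> (Qbar_ratfun \<Rightarrow> Qbar_ratfun) \<Rightarrow> Qbar_ratfun set \<Rightarrow> Qbar_ratfun \<Rightarrow> bool"
  where "summable_in e \<sigma> W h \<longleftrightarrow> h \<in> W \<and> (\<exists>g\<in>W. h = rf_const e * \<sigma> g - g)"

end

theory Submission
  imports Defs
begin

text \<open>
  All three conditions reduce to one linear equation over \<open>F\<close>. Since \<open>\<sigma>\<close> is
  multiplicative, fixes \<open>F\<close> and scales the variable by \<open>\<lambda>\<close>, it scales \<open>\<alpha>\<^sup>i\<close> by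
  \<open>\<lambda>\<^sup>i\<close>, also for negative \<open>i\<close>
  (\<open>scaling_automorphism_monomial\<close>). An element of \<open>V\<^sub>i\<close> is \<open>a \<alpha>\<^sup>i\<close> with \<open>a \<in> F\<close>, and
  \<open>c \<sigma>(a \<alpha>\<^sup>i) - a \<alpha>\<^sup>i = (c \<lambda>\<^sup>i - 1) a \<alpha>\<^sup>i\<close>; cancelling \<open>\<alpha>\<^sup>i\<close> turns summability of \<open>f \<alpha>\<^sup>i\<close>
  in \<open>V\<^sub>i\<close> into solvability of \<open>f = (c \<lambda>\<^sup>i - 1) a\<close> in \<open>F\<close>
  (\<open>summable_in_V_space_iff\<close>). On constants \<open>\<sigma>\<close> is the identity,
  so summability of \<open>f\<close> in \<open>F = V\<^sub>0\<close> with the factor \<open>c \<lambda>\<^sup>i\<close> is the same equation. As \<open>f \<noteq> 0\<close>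
  and \<open>F\<close> is a field, it is solvable exactly when \<open>c \<lambda>\<^sup>i \<noteq> 1\<close>.
\<close>

lemma rf_const_0 [simp]: "rf_const 0 = 0"
  by (simp add: rf_const_def Zero_fract_def)

lemma rf_const_1 [simp]: "rf_const 1 = 1"
  by (simp add: rf_const_def One_fract_def one_pCons)

lemma rf_const_diff: "rf_const (a - b) = rf_const a - rf_const b"
  by (simp add: rf_const_def)

lemma rf_const_mult: "rf_const (a * b) = rf_const a * rf_const b"
  by (simp add: rf_const_def mult.commute)

lemma rf_const_eq_iff [simp]: "rf_const a = rf_const b \<longleftrightarrow> a = b"
  by (simp add: rf_const_def eq_fract)

lemma rf_var_nonzero [simp]: "rf_var \<noteq> 0"
  by (simp add: rf_var_def Zero_fract_def eq_fract)

lemma rf_const_power: "rf_const (a ^ n) = rf_const a ^ n"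
  by (induction n) (simp_all add: rf_const_mult)

lemma rf_const_inverse: "rf_const (inverse a) = inverse (rf_const a)"
proof (cases "a = 0")
  case False
  then have "rf_const a * rf_const (inverse a) = 1"
    by (simp flip: rf_const_mult)
  then show ?thesis
    by (simp add: inverse_unique)
qed simp

lemma rf_const_powi: "rf_const (a powi i) = rf_const a powi i"
  by (simp add: power_int_def rf_const_power rf_const_inverse)

lemma rf_var_power: "rf_var ^ n = Fraction_Field.Fract (monom 1 n) 1"
proof (induction n)
  case 0
  then show ?case by (simp add: One_fract_def)
next
  case (Suc n)
  then show ?case
    by (simp add: rf_var_def monom_Suc)
qed

lemma rf_const_in_ratfun_field:
  assumes "a \<in> F" and "1 \<in> F"
  shows "rf_const a \<in> ratfun_field F"
proof -
  have "set (coeffs [:a:]) \<subseteq> F" "set (coeffs (1 :: Qbar poly)) \<subseteq> F"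
    using assms by (auto simp: cCons_def)
  then show ?thesis
    unfolding ratfun_field_def rf_const_def using one_neq_zero by blast
qed

lemma rf_var_powi_in_ratfun_field:
  assumes "0 \<in> F" and "1 \<in> F"
  shows "rf_var powi i \<in> ratfun_field F"
proof -
  have coeffs: "set (coeffs (monom (1 :: Qbar) n)) \<subseteq> F" "set (coeffs (1 :: Qbar poly)) \<subseteq> F" for n
    using assms by (auto simp: coeffs_monom)
  have nz: "monom (1 :: Qbar) n \<noteq> 0" for n
    by simp
  show ?thesis
  proof (cases "i \<ge> 0")
    case True
    then have "rf_var powi i = Fraction_Field.Fract (monom 1 (nat i)) 1"
      by (simp add: power_int_def rf_var_power)
    then show ?thesis
      unfolding ratfun_field_def using coeffs one_neq_zero by blast
  next
    case False
    then have "rf_var powi i = Fraction_Field.Fract 1 (monom 1 (nat (- i)))"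
      by (simp add: power_int_def power_inverse rf_var_power)
    then show ?thesis
      unfolding ratfun_field_def using coeffs nz by blast
  qed
qed

lemma V_space_eq:
  "V_space F i = (\<lambda>a. rf_const a * rf_var powi i) ` F"
proof -
  interpret ring Qbar_ratfun_ring
    by (rule ring_from_type_algebra)
  have ops: "\<zero>\<^bsub>Qbar_ratfun_ring\<^esub> = (0 :: Qbar_ratfun)"
    "x \<otimes>\<^bsub>Qbar_ratfun_ring\<^esub> y = x * y" "x \<oplus>\<^bsub>Qbar_ratfun_ring\<^esub> y = x + y"
    for x y :: Qbar_ratfun
    by (simp_all add: ring_of_type_algebra_def)
  show ?thesis
    unfolding V_space_def by (auto simp: line_extension_mem_iff ops)
qed

lemma subfield_Qbar_closed:
  assumes "subfield F Qbar_ring"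
  shows "0 \<in> F" and "1 \<in> F"
    and "a \<in> F \<Longrightarrow> b \<in> F \<Longrightarrow> a - b \<in> F"
    and "a \<in> F \<Longrightarrow> b \<in> F \<Longrightarrow> a * b \<in> F"
    and "a \<in> F \<Longrightarrow> inverse a \<in> F"
proof -
  interpret field Qbar_ring
    by (rule field_from_type_algebra)
  have ops: "\<zero>\<^bsub>Qbar_ring\<^esub> = (0 :: Qbar)" "\<one>\<^bsub>Qbar_ring\<^esub> = (1 :: Qbar)"
    "x \<otimes>\<^bsub>Qbar_ring\<^esub> y = x * y" "x \<oplus>\<^bsub>Qbar_ring\<^esub> y = x + y" for x y :: Qbar
    by (simp_all add: ring_of_type_algebra_def)
  have subring: "subring F Qbar_ring"
    using assms by (rule subfieldE(1))
  show zero: "0 \<in> F" and "1 \<in> F"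
    using subringE(2,3)[OF subring] by (simp_all add: ops)
  show mult: "a * b \<in> F" if "a \<in> F" "b \<in> F" for a b
    using subringE(6)[OF subring that] by (simp add: ops)
  show "a - b \<in> F" if "a \<in> F" "b \<in> F" for a b
  proof -
    have "\<ominus>\<^bsub>Qbar_ring\<^esub> b = - b"
      by (rule minus_equality) (simp_all add: ops, simp_all add: ring_of_type_algebra_def)
    then show ?thesis
      using subringE(7)[OF subring that(1) subringE(5)[OF subring that(2)]] by (simp add: ops)
  qed
  show "inverse a \<in> F" if "a \<in> F" for a
  proof (cases "a = 0")
    case False
    with that have "a \<in> F - {\<zero>\<^bsub>Qbar_ring\<^esub>}"
      by (simp add: ops)
    note inv = subfield_m_inv[OF assms this]
    then have "inverse a = inv\<^bsub>Qbar_ring\<^esub> a"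
      by (intro inverse_unique) (simp add: ops)
    then show ?thesis
      using inv(1) by simp
  qed (simp add: zero)
qed

text \<open>
  Multiplicativity is only available on \<open>F(\<alpha>)\<close>, so that both \<open>\<alpha>\<^sup>n\<close> and its inverse
  must lie there; \<open>\<sigma> 1 = 1\<close> then carries the formula from positive to negative exponents.
\<close>

lemma scaling_automorphism_monomial:
  assumes F: "subfield F Qbar_ring" and \<sigma>: "scaling_automorphism F lam \<sigma>" and "a \<in> F"
  shows "\<sigma> (rf_const a * rf_var powi i) = rf_const (a * lam powi i) * rf_var powi i"
proof -
  note closed = subfield_Qbar_closed[OF F]
  note mem = rf_const_in_ratfun_field[OF _ closed(2)] rf_var_powi_in_ratfun_field[OF closed(1,2)]
  have hom: "\<sigma> \<in> ring_hom (ratfun_field_ring F) (ratfun_field_ring F)"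
    and const: "\<And>b. b \<in> F \<Longrightarrow> \<sigma> (rf_const b) = rf_const b"
    and var: "\<sigma> rf_var = rf_const lam * rf_var"
    using \<sigma> by (auto simp: scaling_automorphism_def ring_iso_def)
  have mult: "\<sigma> (x * y) = \<sigma> x * \<sigma> y" if "x \<in> ratfun_field F" "y \<in> ratfun_field F" for x y
    using ring_hom_mult[OF hom, of x y] that
    by (simp add: ratfun_field_ring_def ring_of_type_algebra_def)
  have one: "\<sigma> 1 = 1"
    using const[OF closed(2)] by simp
  have pow: "\<sigma> (rf_var ^ n) = (rf_const lam * rf_var) ^ n" for n
  proof (induction n)
    case (Suc n)
    then show ?case
      using mult[OF mem(2)[of 1] mem(2)[of "int n"]] by (simp add: var)
  qed (simp add: one)
  have "\<sigma> (rf_var powi i) = (rf_const lam * rf_var) powi i"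
  proof (cases "i \<ge> 0")
    case True
    then show ?thesis
      by (simp add: power_int_def pow)
  next
    case False
    define n where "n = nat (- i)"
    have i: "i = - int n"
      using False by (simp add: n_def)
    have "\<sigma> (rf_var ^ n) * \<sigma> (rf_var powi i) = \<sigma> (rf_var ^ n * rf_var powi i)"
      using mult[OF mem(2)[of "int n"] mem(2)[of i]] by simp
    also have "\<dots> = 1"
      by (simp add: i power_int_minus one)
    finally have "inverse (\<sigma> (rf_var ^ n)) = \<sigma> (rf_var powi i)"
      by (rule inverse_unique)
    then show ?thesis
      by (simp add: pow i power_int_minus)
  qed
  then show ?thesis
    using mult[OF mem(1)[OF \<open>a \<in> F\<close>] mem(2)] const[OF \<open>a \<in> F\<close>]
    by (simp add: rf_const_mult rf_const_powi power_int_mult_distrib mult_ac)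
qed

text \<open>
  The operator \<open>c \<sigma> - 1\<close> acts on the line \<open>V\<^sub>i\<close> as multiplication by the constant
  \<open>c \<lambda>\<^sup>i - 1\<close>. The case \<open>i = 0\<close> covers summability in \<open>F\<close> itself.
\<close>

lemma summable_in_V_space_iff:
  assumes F: "subfield F Qbar_ring" and \<sigma>: "scaling_automorphism F lam \<sigma>" and "f \<in> F"
  shows "summable_in c \<sigma> (V_space F i) (rf_const f * rf_var powi i)
           \<longleftrightarrow> (\<exists>a\<in>F. f = (c * lam powi i - 1) * a)"
proof -
  have "rf_const f * rf_var powi i
          = rf_const c * \<sigma> (rf_const a * rf_var powi i) - rf_const a * rf_var powi i
        \<longleftrightarrow> f = (c * lam powi i - 1) * a" if "a \<in> F" for a
  proof -
    have "rf_const c * \<sigma> (rf_const a * rf_var powi i) - rf_const a * rf_var powi i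
            = rf_const ((c * lam powi i - 1) * a) * rf_var powi i"
      by (simp add: scaling_automorphism_monomial[OF F \<sigma> that] rf_const_mult rf_const_diff
          algebra_simps)
    then show ?thesis
      by simp
  qed
  then show ?thesis
    using \<open>f \<in> F\<close> by (auto simp: summable_in_def V_space_eq)
qed

theorem theorem3p4:
  fixes F :: "Qbar set" and lam c f :: Qbar and i :: int
    and \<sigma> :: "Qbar_ratfun \<Rightarrow> Qbar_ratfun"
  assumes "subfield F Qbar_ring"
    and "lam \<in> F - {0}"
    and "scaling_automorphism F lam \<sigma>"
    and "c \<in> F - {0}"
    and "f \<in> F" and "f \<noteq> 0"
  shows "(summable_in c \<sigma> (V_space F i) (rf_const f * rf_var powi i)
            \<longleftrightarrow> summable_in (c * lam powi i) \<sigma> (rf_const ` F) (rf_const f))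
       \<and> (summable_in (c * lam powi i) \<sigma> (rf_const ` F) (rf_const f)
            \<longleftrightarrow> lam powi i \<noteq> 1 / c)"
proof -
  note closed = subfield_Qbar_closed[OF assms(1)]
  have V: "summable_in c \<sigma> (V_space F i) (rf_const f * rf_var powi i)
      \<longleftrightarrow> (\<exists>a\<in>F. f = (c * lam powi i - 1) * a)"
    using assms by (intro summable_in_V_space_iff)
  have const: "summable_in (c * lam powi i) \<sigma> (rf_const ` F) (rf_const f)
      \<longleftrightarrow> (\<exists>a\<in>F. f = (c * lam powi i - 1) * a)"
    using summable_in_V_space_iff[OF assms(1,3,5), of "c * lam powi i" 0]
    by (simp add: V_space_eq)
  have "lam powi i \<in> F"
  proof -
    have pow: "x ^ n \<in> F" if "x \<in> F" for x n
      using that by (induction n) (auto intro: closed)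
    show ?thesis
      using assms(2) by (auto simp: power_int_def intro: pow closed(5))
  qed
  then have "c * lam powi i - 1 \<in> F"
    using assms(4) closed(2,3,4) by blast
  then have "f * inverse (c * lam powi i - 1) \<in> F"
    using assms(5) closed(4,5) by blast
  moreover have "f = (c * lam powi i - 1) * (f * inverse (c * lam powi i - 1))"
    if "c * lam powi i - 1 \<noteq> 0"
    using that by simp
  ultimately have "(\<exists>a\<in>F. f = (c * lam powi i - 1) * a) \<longleftrightarrow> c * lam powi i - 1 \<noteq> 0"
    using \<open>f \<noteq> 0\<close> by (metis mult_zero_left)
  also have "\<dots> \<longleftrightarrow> lam powi i \<noteq> 1 / c"
    using assms(4) by (auto simp: field_simps)
  finally show ?thesis
    using V const by blast
qed

end
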